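(* Let $X$ be a real Banach space with $\dim X\geqslant 2$. Then for every $t\in[0,\frac12)$, $$\frac12J^2(X)-2tJ(X)+2t^2\leqslant L_X(t)\leqslant\frac{2t^2-2t+1}{4}J^2(X)+(2t-2t^2)J(X)+2t^2-2t+1.$$
   Context: For $x,y$ in a real Banach space $X$, isosceles orthogonality $x\perp_I y$ means $\|x+y\|=\|x-y\|$. For $0\leqslant t<\frac12$ define $$L_X(t)=\sup\left\{\frac{\|tx+(1-t)y\|^2+\|(1-t)x+ty\|^2}{\|x+y\|^2}: x,y\in X,\ (x,y)\neq(0,0),\ x\perp_I y\right\}.$$ Let $S_X=\{x\in X:\|x\|=1\}$. The James constant is $$J(X)=\sup\{\min\{\|x+y\|,\|x-y\|\}: x,y\in S_X\},$$ and $J^2(X)$ denotes $(J(X))^2$. *)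

theory Defs
  imports "HOL-Analysis.Analysis"
begin

definition isosceles_orth :: "'a::real_normed_vector \<Rightarrow> 'a \<Rightarrow> bool"
    (infix "\<bottom>\<^sub>I" 50)
  where "x \<bottom>\<^sub>I y \<longleftrightarrow> norm (x + y) = norm (x - y)"

(* The space X is the type 'a, passed to the constants as TYPE('a). If X is not {0}, both
   sets below are nonempty and bounded above (for 0 \<le> t < 1/2), so the real-valued Sup is the
   actual least upper bound. The denominators in L_set never vanish. *)

definition L_set :: "'a::real_normed_vector itself \<Rightarrow> real \<Rightarrow> real set" where
  "L_set X t =
     {((norm (t *\<^sub>R x + (1 - t) *\<^sub>R y))\<^sup>2 + (norm ((1 - t) *\<^sub>R x + t *\<^sub>R y))\<^sup>2) / (norm (x + y))\<^sup>2
       | (x::'a) (y::'a). (x, y) \<noteq> (0, 0) \<and> x \<bottom>\<^sub>I y}"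

definition L_const :: "'a::real_normed_vector itself \<Rightarrow> real \<Rightarrow> real" where
  "L_const X t = Sup (L_set X t)"

definition James_set :: "'a::real_normed_vector itself \<Rightarrow> real set" where
  "James_set X =
     {min (norm (x + y)) (norm (x - y)) | (x::'a) (y::'a). x \<in> sphere 0 1 \<and> y \<in> sphere 0 1}"

definition James_const :: "'a::real_normed_vector itself \<Rightarrow> real" where
  "James_const X = Sup (James_set X)"

lemma isosceles_orth_sum_nonzero:
  fixes x y :: "'a::real_normed_vector"
  assumes "x \<bottom>\<^sub>I y" "(x, y) \<noteq> (0, 0)"
  shows "x + y \<noteq> 0"
proof
  assume s: "x + y = 0"
  with assms(1) have "x - y = 0"
    by (simp add: isosceles_orth_def)
  with s have "2 *\<^sub>R x = 0"
    by (simp add: scaleR_2)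
  with s assms(2) show False
    by auto
qed

lemma L_set_bdd_above:
  assumes "0 \<le> t" "t < 1 / 2"
  shows "bdd_above (L_set TYPE('a::real_normed_vector) t)"
proof (rule bdd_aboveI[where M = 2])
  fix r assume "r \<in> L_set TYPE('a) t"
  then obtain x y :: 'a where nz: "(x, y) \<noteq> (0, 0)" and I: "x \<bottom>\<^sub>I y"
    and r: "r = ((norm (t *\<^sub>R x + (1 - t) *\<^sub>R y))\<^sup>2 + (norm ((1 - t) *\<^sub>R x + t *\<^sub>R y))\<^sup>2)
                  / (norm (x + y))\<^sup>2"
    unfolding L_set_def by blast
  let ?n = "norm (x + y)"
  have eq: "norm (x - y) = ?n"
    using I by (simp add: isosceles_orth_def)
  have half: "norm ((1/2) *\<^sub>R (x + y)) = ?n / 2" "norm ((1/2 - t) *\<^sub>R (x - y)) = (1/2 - t) * ?n"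
    using assms eq by simp_all
  have le: "(1/2) * ?n + (1/2 - t) * ?n \<le> ?n"
    using assms by (simp add: algebra_simps)
  have hx: "z = (1/2) *\<^sub>R z + (1/2) *\<^sub>R z" for z :: 'a
    by (simp flip: scaleR_left_distrib)
  have "t *\<^sub>R x + (1 - t) *\<^sub>R y = (1/2) *\<^sub>R (x + y) - (1/2 - t) *\<^sub>R (x - y)"
    using hx[of y] by (simp add: algebra_simps)
  then have 1: "norm (t *\<^sub>R x + (1 - t) *\<^sub>R y) \<le> ?n"
    using norm_triangle_ineq4[of "(1/2) *\<^sub>R (x + y)" "(1/2 - t) *\<^sub>R (x - y)"] half le by simp
  have "(1 - t) *\<^sub>R x + t *\<^sub>R y = (1/2) *\<^sub>R (x + y) + (1/2 - t) *\<^sub>R (x - y)"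
    using hx[of x] by (simp add: algebra_simps)
  then have 2: "norm ((1 - t) *\<^sub>R x + t *\<^sub>R y) \<le> ?n"
    using norm_triangle_ineq[of "(1/2) *\<^sub>R (x + y)" "(1/2 - t) *\<^sub>R (x - y)"] half le by simp
  have "?n > 0"
    using isosceles_orth_sum_nonzero[OF I nz] by simp
  moreover have "(norm (t *\<^sub>R x + (1 - t) *\<^sub>R y))\<^sup>2 + (norm ((1 - t) *\<^sub>R x + t *\<^sub>R y))\<^sup>2 \<le> 2 * ?n\<^sup>2"
    using power_mono[OF 1 norm_ge_zero, of 2] power_mono[OF 2 norm_ge_zero, of 2] by linarith
  ultimately show "r \<le> 2"
    unfolding r by (simp add: divide_le_eq)
qed

lemma L_set_nonempty:
  assumes "(x::'a::real_normed_vector) \<noteq> 0"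
  shows "L_set TYPE('a) t \<noteq> {}"
proof -
  have "(x, 0) \<noteq> (0, 0)" "x \<bottom>\<^sub>I 0"
    using assms by (simp_all add: isosceles_orth_def)
  then show ?thesis
    unfolding L_set_def by blast
qed

lemma James_set_bdd_above: "bdd_above (James_set TYPE('a::real_normed_vector))"
proof (rule bdd_aboveI[where M = 2])
  fix r assume "r \<in> James_set TYPE('a)"
  then obtain x y :: 'a where "norm x = 1" "norm y = 1" "r = min (norm (x + y)) (norm (x - y))"
    by (auto simp: James_set_def)
  then show "r \<le> 2"
    using norm_triangle_ineq[of x y] by simp
qed

lemma James_set_nonempty:
  assumes "(x::'a::real_normed_vector) \<noteq> 0"
  shows "James_set TYPE('a) \<noteq> {}"
proof -
  have "sgn x \<in> sphere 0 1"
    using assms by (simp add: norm_sgn)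
  then show ?thesis
    unfolding James_set_def by blast
qed

end

(* With u = x + y and v = x - y, isosceles orthogonality says that u and v have equal norm,
   so L_X(t) is a supremum over pairs of unit vectors u, v, as J(X) is. Here
   (1 - t) x + t y and t x + (1 - t) y are, up to the factor 1/2, equal to u + (1 - 2t) v and
   u - (1 - 2t) v. The lower bound comes from |u + (1 - 2t) v| \<ge> |u + v| - 2t and the same
   with -v. The upper bound comes from |t x + (1 - t) y| \<le> t |x| + (1 - t) |y|, where the
   smaller of 2|x|, 2|y| is at most J(X) |u| and the larger at most 2 |u|. *)
theory Submission imports Defs begin

lemma James_const_upper:
  fixes u v :: "'a::real_normed_vector"
  assumes "norm u = 1" "norm v = 1"
  shows "min (norm (u + v)) (norm (u - v)) \<le> James_const TYPE('a)"
  unfolding James_const_def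
  by (rule cSup_upper[OF _ James_set_bdd_above]) (use assms in \<open>auto simp: James_set_def\<close>)

text \<open>By homogeneity: dividing \<open>u\<close> and \<open>v\<close> by their common norm
  \<open>n\<close> gives unit vectors.\<close>

lemma James_const_upper_scaled:
  fixes u v :: "'a::real_normed_vector"
  assumes "norm u = n" "norm v = n" "n > 0"
  shows "min (norm (u + v)) (norm (u - v)) \<le> James_const TYPE('a) * n"
proof -
  have "min (norm (u /\<^sub>R n + v /\<^sub>R n)) (norm (u /\<^sub>R n - v /\<^sub>R n)) \<le> James_const TYPE('a)"
    by (rule James_const_upper) (use assms in auto)
  moreover have "norm (u /\<^sub>R n + v /\<^sub>R n) = norm (u + v) / n"
    "norm (u /\<^sub>R n - v /\<^sub>R n) = norm (u - v) / n"
    using \<open>n > 0\<close>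
    by (simp_all add: divide_inverse flip: scaleR_right_distrib scaleR_right_diff_distrib)
  ultimately have "min (norm (u + v) / n) (norm (u - v) / n) \<le> James_const TYPE('a)"
    by simp
  then show ?thesis
    using \<open>n > 0\<close> by (simp add: min_le_iff_disj pos_divide_le_eq)
qed

text \<open>The pair \<open>sgn x\<close>, \<open>sgn x\<close> has a sum of norm 2 and difference
  0, so the supremum is taken over a set containing 0.\<close>

lemma James_const_nonneg:
  assumes "(x::'a::real_normed_vector) \<noteq> 0"
  shows "0 \<le> James_const TYPE('a)"
  using James_const_upper[of "sgn x" "sgn x"] assms by (simp add: norm_sgn)

text \<open>Orthogonality gives \<open>x + y\<close> and \<open>x - y\<close> the same norm, so the
  James bound applies to this pair; its sum and difference are twice \<open>x\<close> and twice
  \<open>y\<close>.\<close>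

lemma isosceles_orth_min_norm_le:
  fixes x y :: "'a::real_normed_vector"
  assumes "x \<bottom>\<^sub>I y" "(x, y) \<noteq> (0, 0)"
  shows "2 * min (norm x) (norm y) \<le> James_const TYPE('a) * norm (x + y)"
proof -
  have "min (norm ((x + y) + (x - y))) (norm ((x + y) - (x - y)))
          \<le> James_const TYPE('a) * norm (x + y)"
    using assms isosceles_orth_sum_nonzero[OF assms]
    by (intro James_const_upper_scaled) (auto simp: isosceles_orth_def)
  moreover have "(x + y) + (x - y) = 2 *\<^sub>R x" "(x + y) - (x - y) = 2 *\<^sub>R y"
    by (simp_all add: scaleR_2)
  ultimately show ?thesis
    by (simp add: min_def split: if_splits)
qed

lemma isosceles_orth_max_norm_le:
  fixes x y :: "'a::real_normed_vector"
  assumes "x \<bottom>\<^sub>I y"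
  shows "norm x \<le> norm (x + y)" "norm y \<le> norm (x + y)"
proof -
  have "2 *\<^sub>R x = (x + y) + (x - y)" "2 *\<^sub>R y = (x + y) - (x - y)"
    by (simp_all add: scaleR_2)
  then have "2 * norm x \<le> norm (x + y) + norm (x - y)"
    "2 * norm y \<le> norm (x + y) + norm (x - y)"
    using norm_triangle_ineq[of "x + y" "x - y"] norm_triangle_ineq4[of "x + y" "x - y"]
    by (metis norm_scaleR abs_numeral)+
  then show "norm x \<le> norm (x + y)" "norm y \<le> norm (x + y)"
    using assms by (simp_all add: isosceles_orth_def)
qed

text \<open>Exchanging \<open>a\<close> and \<open>b\<close> exchanges the two squares, so the
  smaller of them may be taken as the first. It is then at most \<open>j * n / 2\<close> and the
  other at most \<open>n\<close>; the right-hand side is the left-hand side evaluated at these two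
  extreme values.\<close>

lemma weighted_squares_le:
  fixes t a b j n :: real
  assumes t: "0 \<le> t" "t \<le> 1" and ab: "0 \<le> a" "0 \<le> b"
    and min: "2 * min a b \<le> j * n" and max: "a \<le> n" "b \<le> n"
  shows "(t * a + (1 - t) * b)\<^sup>2 + ((1 - t) * a + t * b)\<^sup>2
    \<le> ((2 * t\<^sup>2 - 2 * t + 1) / 4 * j\<^sup>2 + (2 * t - 2 * t\<^sup>2) * j + 2 * t\<^sup>2 - 2 * t + 1) * n\<^sup>2"
proof -
  have *: "(t * a + (1 - t) * b)\<^sup>2 + ((1 - t) * a + t * b)\<^sup>2
      \<le> ((2 * t\<^sup>2 - 2 * t + 1) / 4 * j\<^sup>2 + (2 * t - 2 * t\<^sup>2) * j + 2 * t\<^sup>2 - 2 * t + 1) * n\<^sup>2"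
    if "0 \<le> a" "a \<le> j * n / 2" "0 \<le> b" "b \<le> n" for a b
  proof -
    have "t * a + (1 - t) * b \<le> t * (j * n / 2) + (1 - t) * n"
      "(1 - t) * a + t * b \<le> (1 - t) * (j * n / 2) + t * n"
      using t that by (intro add_mono mult_left_mono; simp)+
    then have "(t * a + (1 - t) * b)\<^sup>2 \<le> (t * (j * n / 2) + (1 - t) * n)\<^sup>2"
      "((1 - t) * a + t * b)\<^sup>2 \<le> ((1 - t) * (j * n / 2) + t * n)\<^sup>2"
      using t that by (auto intro!: power_mono)
    then have "(t * a + (1 - t) * b)\<^sup>2 + ((1 - t) * a + t * b)\<^sup>2
      \<le> (t * (j * n / 2) + (1 - t) * n)\<^sup>2 + ((1 - t) * (j * n / 2) + t * n)\<^sup>2"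
      by linarith
    also have "\<dots> = ((2 * t\<^sup>2 - 2 * t + 1) / 4 * j\<^sup>2 + (2 * t - 2 * t\<^sup>2) * j
        + 2 * t\<^sup>2 - 2 * t + 1) * n\<^sup>2"
      by (simp add: power2_eq_square field_simps)
    finally show ?thesis .
  qed
  show ?thesis
  proof (cases "a \<le> b")
    case True
    then show ?thesis using *[of a b] assms by (simp add: min_def)
  next
    case False
    then show ?thesis using *[of b a] assms by (simp add: min_def add.commute)
  qed
qed

text \<open>The triangle inequality reduces each quotient to the numbers \<open>norm x\<close> and
  \<open>norm y\<close>, to which \<open>weighted_squares_le\<close> applies with
  \<open>n = norm (x + y)\<close> and \<open>j\<close> the James constant. The vector
  \<open>z\<close> guarantees a nonempty \<open>L_set\<close>, as \<open>cSup_least\<close>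
  requires.\<close>

lemma L_const_le:
  assumes nz: "(z::'a::real_normed_vector) \<noteq> 0" and t: "0 \<le> t" "t \<le> 1"
  shows "L_const TYPE('a) t
    \<le> (2 * t\<^sup>2 - 2 * t + 1) / 4 * (James_const TYPE('a))\<^sup>2
      + (2 * t - 2 * t\<^sup>2) * James_const TYPE('a) + 2 * t\<^sup>2 - 2 * t + 1" (is "_ \<le> ?R")
  unfolding L_const_def
proof (rule cSup_least[OF L_set_nonempty[OF nz]])
  fix r assume "r \<in> L_set TYPE('a) t"
  then obtain x y :: 'a where xy: "(x, y) \<noteq> (0, 0)" and I: "x \<bottom>\<^sub>I y"
    and r: "r = ((norm (t *\<^sub>R x + (1 - t) *\<^sub>R y))\<^sup>2 + (norm ((1 - t) *\<^sub>R x + t *\<^sub>R y))\<^sup>2)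
                  / (norm (x + y))\<^sup>2"
    unfolding L_set_def by blast
  have "norm (t *\<^sub>R x + (1 - t) *\<^sub>R y) \<le> t * norm x + (1 - t) * norm y"
    "norm ((1 - t) *\<^sub>R x + t *\<^sub>R y) \<le> (1 - t) * norm x + t * norm y"
    using t by (auto intro!: norm_triangle_le)
  then have "(norm (t *\<^sub>R x + (1 - t) *\<^sub>R y))\<^sup>2 + (norm ((1 - t) *\<^sub>R x + t *\<^sub>R y))\<^sup>2
      \<le> (t * norm x + (1 - t) * norm y)\<^sup>2 + ((1 - t) * norm x + t * norm y)\<^sup>2"
    by (intro add_mono power_mono) auto
  also have "\<dots> \<le> ?R * (norm (x + y))\<^sup>2"
    using t isosceles_orth_min_norm_le[OF I xy] isosceles_orth_max_norm_le[OF I]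
    by (intro weighted_squares_le) auto
  finally show "r \<le> ?R"
    using isosceles_orth_sum_nonzero[OF I xy] unfolding r by (simp add: divide_le_eq)
qed

text \<open>The orthogonal pair \<open>u + v\<close>, \<open>u - v\<close> has sum
  \<open>2 *\<^sub>R u\<close> and difference \<open>2 *\<^sub>R v\<close>, both of norm 2; hence
  the denominator 4.\<close>

lemma L_const_ge_unit_vectors:
  fixes u v :: "'a::real_normed_vector"
  assumes t: "0 \<le> t" "t < 1 / 2" and uv: "norm u = 1" "norm v = 1"
  shows "((norm (u - (1 - 2 * t) *\<^sub>R v))\<^sup>2 + (norm (u + (1 - 2 * t) *\<^sub>R v))\<^sup>2) / 4
           \<le> L_const TYPE('a) t"
proof -
  let ?x = "u + v" and ?y = "u - v"
  have "?x + ?y = 2 *\<^sub>R u" "?x - ?y = 2 *\<^sub>R v"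
    by (simp_all add: scaleR_2)
  then have n: "norm (?x + ?y) = 2" "norm (?x - ?y) = 2"
    using uv by simp_all
  then have "?x \<bottom>\<^sub>I ?y" "(?x, ?y) \<noteq> (0, 0)"
    by (auto simp: isosceles_orth_def)
  then have "((norm (t *\<^sub>R ?x + (1 - t) *\<^sub>R ?y))\<^sup>2 + (norm ((1 - t) *\<^sub>R ?x + t *\<^sub>R ?y))\<^sup>2)
      / (norm (?x + ?y))\<^sup>2 \<in> L_set TYPE('a) t"
    unfolding L_set_def by blast
  moreover have "t *\<^sub>R ?x + (1 - t) *\<^sub>R ?y = u - (1 - 2 * t) *\<^sub>R v"
    "(1 - t) *\<^sub>R ?x + t *\<^sub>R ?y = u + (1 - 2 * t) *\<^sub>R v"
    by (simp_all add: algebra_simps scaleR_2 flip: scaleR_scaleR)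
  ultimately show ?thesis
    unfolding L_const_def n by (intro cSup_upper L_set_bdd_above t) simp
qed

text \<open>Take \<open>u = v\<close> in the preceding bound. This serves \<open>L_const_ge\<close>
  when the James constant is below \<open>2 * t\<close>.\<close>

lemma L_const_ge_trivial:
  assumes nz: "(z::'a::real_normed_vector) \<noteq> 0" and t: "0 \<le> t" "t < 1 / 2"
  shows "2 * t\<^sup>2 - 2 * t + 1 \<le> L_const TYPE('a) t"
proof -
  have "sgn z - (1 - 2 * t) *\<^sub>R sgn z = (2 * t) *\<^sub>R sgn z"
    "sgn z + (1 - 2 * t) *\<^sub>R sgn z = (2 - 2 * t) *\<^sub>R sgn z"
    by (simp_all add: algebra_simps scaleR_2)
  then have "((2 * t)\<^sup>2 + (2 - 2 * t)\<^sup>2) / 4 \<le> L_const TYPE('a) t"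
    using L_const_ge_unit_vectors[OF t, of "sgn z" "sgn z"] nz t by (simp add: norm_sgn)
  then show ?thesis
    by (simp add: power2_eq_square field_simps)
qed

text \<open>The quadratic estimate \<open>(r - 2 * t)\<^sup>2 \<le> 2 * L\<close> for members
  \<open>r \<ge> 2 * t\<close> of \<open>James_set\<close> is solved for \<open>r\<close>, because
  only a bound linear in \<open>r\<close> passes directly to the supremum.\<close>

lemma James_const_le_sqrt_L_const:
  assumes nz: "(z::'a::real_normed_vector) \<noteq> 0" and t: "0 \<le> t" "t < 1 / 2"
  shows "James_const TYPE('a) \<le> 2 * t + sqrt (2 * L_const TYPE('a) t)"
  unfolding James_const_def
proof (rule cSup_least[OF James_set_nonempty[OF nz]])
  fix r assume "r \<in> James_set TYPE('a)"
  then obtain u v :: 'a where uv: "norm u = 1" "norm v = 1"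
    and r: "r = min (norm (u + v)) (norm (u - v))"
    by (auto simp: James_set_def)
  let ?s = "1 - 2 * t"
  have L: "((norm (u - ?s *\<^sub>R v))\<^sup>2 + (norm (u + ?s *\<^sub>R v))\<^sup>2) / 4 \<le> L_const TYPE('a) t"
    by (rule L_const_ge_unit_vectors[OF t uv])
  have "u - v = (u - ?s *\<^sub>R v) - (2 * t) *\<^sub>R v" "u + v = (u + ?s *\<^sub>R v) + (2 * t) *\<^sub>R v"
    by (simp_all add: algebra_simps)
  then have "norm (u - v) \<le> norm (u - ?s *\<^sub>R v) + norm ((2 * t) *\<^sub>R v)"
    "norm (u + v) \<le> norm (u + ?s *\<^sub>R v) + norm ((2 * t) *\<^sub>R v)"
    by (metis norm_triangle_ineq4, metis norm_triangle_ineq)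
  then have le: "r - 2 * t \<le> norm (u - ?s *\<^sub>R v)" "r - 2 * t \<le> norm (u + ?s *\<^sub>R v)"
    using uv t r by auto
  have "r - 2 * t \<le> sqrt (2 * L_const TYPE('a) t)"
  proof (cases "0 \<le> r - 2 * t")
    case True
    \<comment> \<open>Both squared norms in \<open>L\<close> are at least
      \<open>(r - 2 * t)\<^sup>2\<close>, so a quarter of their sum is at least half of it.\<close>
    have "c \<le> a \<Longrightarrow> c \<le> b \<Longrightarrow> (a + b) / 4 \<le> d \<Longrightarrow> c \<le> 2 * d" for a b c d :: real
      by simp
    from this[OF power_mono[OF le(1) True] power_mono[OF le(2) True] L]
    have "(r - 2 * t)\<^sup>2 \<le> 2 * L_const TYPE('a) t" .
    then show ?thesis
      by (rule real_le_rsqrt)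
  next
    case False
    \<comment> \<open>The sign matters: \<open>sqrt\<close> is an odd function here, negative on
      negative arguments.\<close>
    moreover have "0 \<le> L_const TYPE('a) t"
      using L by (smt (verit) zero_le_power2 divide_nonneg_nonneg)
    ultimately show ?thesis
      by (smt (verit) real_sqrt_ge_zero)
  qed
  then show "r \<le> 2 * t + sqrt (2 * L_const TYPE('a) t)"
    by simp
qed

lemma L_const_ge:
  assumes nz: "(z::'a::real_normed_vector) \<noteq> 0" and t: "0 \<le> t" "t < 1 / 2"
  shows "1 / 2 * (James_const TYPE('a))\<^sup>2 - 2 * t * James_const TYPE('a) + 2 * t\<^sup>2
           \<le> L_const TYPE('a) t"
proof -
  let ?J = "James_const TYPE('a)" and ?L = "L_const TYPE('a) t"
  have triv: "2 * t\<^sup>2 - 2 * t + 1 \<le> ?L"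
    by (rule L_const_ge_trivial[OF nz t])
  \<comment> \<open>Half of this inequality, expanded, is the claim.\<close>
  have "(?J - 2 * t)\<^sup>2 \<le> 2 * ?L"
  proof (cases "2 * t \<le> ?J")
    case True
    have "0 \<le> ?L"
      using triv t zero_le_power2[of t] by linarith
    then show ?thesis
      using James_const_le_sqrt_L_const[OF nz t] True
        power_mono[of "?J - 2 * t" "sqrt (2 * ?L)" 2] by simp
  next
    case False
    \<comment> \<open>Here \<open>0 \<le> ?J < 2 * t\<close>, so the square is at most
      \<open>4 * t\<^sup>2\<close>. Since \<open>t < 1 / 2\<close>, this is at most
      \<open>4 * t\<^sup>2 - 4 * t + 2\<close>, which \<open>triv\<close> bounds by
      \<open>2 * ?L\<close>.\<close>
    then have "(2 * t - ?J)\<^sup>2 \<le> (2 * t)\<^sup>2"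
      using James_const_nonneg[OF nz] by (intro power_mono) auto
    then show ?thesis
      using triv t by (simp add: power2_commute[of ?J] power_mult_distrib)
  qed
  then show ?thesis
    by (simp add: power2_eq_square field_simps)
qed

theorem proposition6:
  fixes t :: real
  assumes dim_ge_2: "\<exists>B::'a::banach set. independent B \<and> card B = 2"
    and t: "0 \<le> t" "t < 1 / 2"
  shows "1 / 2 * (James_const TYPE('a))\<^sup>2 - 2 * t * James_const TYPE('a) + 2 * t\<^sup>2
           \<le> L_const TYPE('a) t
       \<and> L_const TYPE('a) t
           \<le> (2 * t\<^sup>2 - 2 * t + 1) / 4 * (James_const TYPE('a))\<^sup>2
             + (2 * t - 2 * t\<^sup>2) * James_const TYPE('a) + 2 * t\<^sup>2 - 2 * t + 1"
proof -
  \<comment> \<open>A set of cardinality 2 is nonempty, and an independent one does not contain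
    0.\<close>
  obtain z :: 'a where "z \<noteq> 0"
    using dim_ge_2 dependent_zero by (metis card.empty ex_in_conv zero_neq_numeral)
  then show ?thesis
    using L_const_ge[OF _ t] L_const_le[of z t] t by simp
qed

end
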